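(* Let $n \ge 1$, let $N = 2^n$, and let $H \in \mathbb{C}^{N\times N}$ be a Hermitian matrix. Let $Z \subseteq \mathbb{C}^{N}$ be a subspace of dimension $d$ and let $S \in \mathbb{C}^{N \times d}$ be a matrix whose columns form an orthonormal basis of $Z$, so that $S^\dagger S = I$ and $P_Z = S S^\dagger$ is the orthogonal projection onto $Z$. Set $$H_Z = P_Z H P_Z \in \mathbb{C}^{N\times N}, \qquad \widehat{H}_Z = S^\dagger H S \in \mathbb{C}^{d \times d}.$$ Let $|\psi_0\rangle \in \mathbb{C}^N$ be a quantum state, let $|\widehat{\psi}_0\rangle = S^\dagger |\psi_0\rangle$, and let $|\psi_t\rangle$ and $|\widehat{\psi}_t\rangle$ ($t \ge 0$) be the solutions of $$\partial_t |\psi_t\rangle = -i H_Z |\psi_t\rangle \quad\text{and}\quad \partial_t |\widehat{\psi}_t\rangle = -i \widehat{H}_Z |\widehat{\psi}_t\rangle$$ with initial values $|\psi_0\rangle$ and $|\widehat{\psi}_0\rangle$, respectively. Put $r = (I - P_Z)|\psi_0\rangle$. Then for all $t \ge 0$ $$|\psi_t\rangle - r = S |\widehat{\psi}_t\rangle .$$ Moreover, with $U_Z(t) = \exp(-it H_Z)$ and $\widehat{U}_Z(t) = \exp(-it \widehat{H}_Z)$, for all $t \ge 0$ $$U_Z(t)|\psi_0\rangle - r = S|\widehat{\psi}_t\rangle = S \exp(-it\widehat{H}_Z) S^\dagger |\psi_0\rangle = S\, \widehat{U}_Z(t)\, S^\dagger |\psi_0\rangle .$$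
   Context: A quantum state on $n$ qubits is a unit vector in $\mathbb{C}^{2^n}$. $\dagger$ denotes matrix transposition with complex conjugation, $I$ is the identity matrix of the appropriate size, and $\exp(M) = \sum_{k\ge 0} M^k/k!$ is the matrix exponential. *)

theory Defs
  imports Complex_Main "Jordan_Normal_Form.Schur_Decomposition"
begin

definition hermitian_mat :: "complex mat \<Rightarrow> bool" where
  "hermitian_mat A \<longleftrightarrow> mat_adjoint A = A"

definition cvec_norm :: "complex vec \<Rightarrow> real" where
  "cvec_norm v = sqrt (Re (v \<bullet>c v))"

definition quantum_state :: "nat \<Rightarrow> complex vec \<Rightarrow> bool" where
  "quantum_state n v \<longleftrightarrow> v \<in> carrier_vec (2 ^ n) \<and> cvec_norm v = 1"

definition cvec_subspace :: "nat \<Rightarrow> complex vec set \<Rightarrow> nat \<Rightarrow> bool" where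
  "cvec_subspace N Z d \<longleftrightarrow>
     VectorSpace.subspace class_ring Z (module_vec TYPE(complex) N) \<and>
     vectorspace.dim class_ring ((module_vec TYPE(complex) N)\<lparr>carrier := Z\<rparr>) = d"

(* The library's basis predicate is about sets, so it does not see repeated columns;
   the orthonormality conditions exclude repetitions. *)
definition orthonormal_basis_cols :: "nat \<Rightarrow> complex vec set \<Rightarrow> complex mat \<Rightarrow> bool" where
  "orthonormal_basis_cols N Z S \<longleftrightarrow>
     vectorspace.basis class_ring ((module_vec TYPE(complex) N)\<lparr>carrier := Z\<rparr>) (set (cols S)) \<and>
     (\<forall>i < dim_col S. \<forall>j < dim_col S. col S i \<bullet>c col S j = (if i = j then 1 else 0))"

definition is_orthogonal_projection :: "nat \<Rightarrow> complex vec set \<Rightarrow> complex mat \<Rightarrow> bool" where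
  "is_orthogonal_projection N Z P \<longleftrightarrow> P \<in> carrier_mat N N \<and>
     (\<forall>v \<in> carrier_vec N. P *\<^sub>v v \<in> Z \<and> (\<forall>z \<in> Z. (v - P *\<^sub>v v) \<bullet>c z = 0))"

(* The exponential series, summed entrywise; for a square matrix every entry series
   converges absolutely. *)
definition mat_exp :: "complex mat \<Rightarrow> complex mat" where
  "mat_exp A = mat (dim_row A) (dim_row A) (\<lambda>(i, j). \<Sum>k. (A ^\<^sub>m k) $$ (i, j) / fact k)"

(* The type of vectors of all lengths is not a normed space, so curves are
   differentiated componentwise. *)
definition has_cvec_derivative ::
  "(real \<Rightarrow> complex vec) \<Rightarrow> complex vec \<Rightarrow> real filter \<Rightarrow> bool" where
  "has_cvec_derivative f f' F \<longleftrightarrow>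
     (\<forall>i < dim_vec f'. ((\<lambda>s. f s $ i) has_vector_derivative f' $ i) F)"

(* Solutions on [0, \<infinity>); the derivative at time 0 is one-sided. *)
definition schroedinger_solution ::
  "complex mat \<Rightarrow> complex vec \<Rightarrow> (real \<Rightarrow> complex vec) \<Rightarrow> bool" where
  "schroedinger_solution A v \<psi> \<longleftrightarrow> \<psi> 0 = v \<and>
     (\<forall>t \<ge> 0. \<psi> t \<in> carrier_vec (dim_row A) \<and>
        has_cvec_derivative \<psi> ((- \<i>) \<cdot>\<^sub>v (A *\<^sub>v \<psi> t)) (at t within {0..}))"

end

theory Submission
  imports Defs
begin

text \<open>Since \<open>S\<close> is an isometry with range \<open>Z\<close>, it intertwines the two generators,
  \<open>H\<^sub>Z S = S H\<^sub>Z'\<close>, and \<open>H\<^sub>Z\<close> annihilates \<open>r\<close>. Hence \<open>S \<psi>' + r\<close> solves the equation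
  for \<open>H\<^sub>Z\<close>; it starts at \<open>S S\<^sup>\<dagger> \<psi>\<^sub>0 + r = \<psi>\<^sub>0\<close>. The exponential curve solves that equation
  too, and solutions are unique because the norm is conserved.\<close>

section \<open>Adjoints\<close>

lemma mult_mat_vec_index_sum:
  assumes "A \<in> carrier_mat m n" "v \<in> carrier_vec n" "i < m"
  shows "(A *\<^sub>v v) $ i = (\<Sum>j<n. A $$ (i, j) * v $ j)"
  using assms by (auto simp: scalar_prod_def atLeast0LessThan)

lemma mat_adjoint_carrier [simp]:
  "A \<in> carrier_mat m n \<Longrightarrow> mat_adjoint A \<in> carrier_mat n m"
  by (auto simp: mat_adjoint_def)

lemma mat_adjoint_dim [simp]:
  "dim_row (mat_adjoint A) = dim_col A" "dim_col (mat_adjoint A) = dim_row A"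
  by (simp_all add: mat_adjoint_def)

lemma mat_adjoint_index:
  "i < dim_col A \<Longrightarrow> j < dim_row A \<Longrightarrow> mat_adjoint A $$ (i, j) = conjugate (A $$ (j, i))"
  by (simp add: mat_adjoint_def mat_of_rows_index)

text \<open>Both sides expand to one double sum, taken in opposite orders. \<open>\<bullet>c\<close>
  conjugates its second argument, so a matrix acting there moves to the left as its adjoint.
  Conservation of the norm and orthogonality of the projection residual both rest on this.\<close>

lemma cscalar_mult_mat_vec:
  fixes A :: "complex mat"
  assumes "A \<in> carrier_mat m n" "v \<in> carrier_vec m" "w \<in> carrier_vec n"
  shows "v \<bullet>c (A *\<^sub>v w) = (mat_adjoint A *\<^sub>v v) \<bullet>c w"
proof -
  have "v \<bullet>c (A *\<^sub>v w) = (\<Sum>i<m. \<Sum>j<n. v $ i * cnj (A $$ (i, j)) * cnj (w $ j))"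
    using assms
    by (auto simp: scalar_prod_def sum_distrib_left mult.assoc atLeast0LessThan intro!: sum.cong)
  also have "\<dots> = (\<Sum>j<n. \<Sum>i<m. v $ i * cnj (A $$ (i, j)) * cnj (w $ j))"
    by (rule sum.swap)
  also have "\<dots> = (mat_adjoint A *\<^sub>v v) \<bullet>c w"
    using assms mat_adjoint_carrier[OF assms(1)]
    by (auto simp: scalar_prod_def sum_distrib_left mult_ac atLeast0LessThan mat_adjoint_index
             intro!: sum.cong)
  finally show ?thesis .
qed

lemma mat_adjoint_adjoint [simp]:
  fixes A :: "complex mat"
  shows "mat_adjoint (mat_adjoint A) = A"
  by (rule eq_matI) (simp_all add: mat_adjoint_index)

lemma mat_adjoint_mult:
  fixes A B :: "complex mat"
  assumes "A \<in> carrier_mat m n" "B \<in> carrier_mat n k"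
  shows "mat_adjoint (A * B) = mat_adjoint B * mat_adjoint A"
proof (rule eq_matI)
  fix i j assume "i < dim_row (mat_adjoint B * mat_adjoint A)"
    "j < dim_col (mat_adjoint B * mat_adjoint A)"
  then show "mat_adjoint (A * B) $$ (i, j) = (mat_adjoint B * mat_adjoint A) $$ (i, j)"
    using assms by (auto simp: mat_adjoint_index scalar_prod_def mult_ac intro!: sum.cong)
qed (use assms in auto)

section \<open>The matrix exponential\<close>

text \<open>Induction on \<open>k\<close>: an entry of the next power is a sum of \<open>n\<close>
  terms of norm at most \<open>(real n * b) ^ k * b\<close>. This crude geometric bound suffices
  because the factorials of the exponential series outgrow it.\<close>

lemma pow_mat_entry_bound:
  fixes A :: "complex mat"
  assumes A: "A \<in> carrier_mat n n"
    and b: "\<And>i j. i < n \<Longrightarrow> j < n \<Longrightarrow> norm (A $$ (i, j)) \<le> b"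
    and "i < n" "j < n"
  shows "norm ((A ^\<^sub>m k) $$ (i, j)) \<le> (real n * b) ^ k"
  using \<open>j < n\<close>
proof (induction k arbitrary: j)
  case 0
  then show ?case using A \<open>i < n\<close> by auto
next
  case (Suc k)
  have b0: "0 \<le> b" using b[OF \<open>i < n\<close> \<open>i < n\<close>] norm_ge_zero order_trans by blast
  have "(A ^\<^sub>m Suc k) $$ (i, j) = (\<Sum>l<n. (A ^\<^sub>m k) $$ (i, l) * A $$ (l, j))"
    using A \<open>i < n\<close> Suc.prems pow_carrier_mat[OF A, of k]
    by (auto simp: scalar_prod_def atLeast0LessThan)
  also have "norm \<dots> \<le> (\<Sum>l<n. (real n * b) ^ k * b)"
    by (rule sum_norm_le)
      (auto simp: norm_mult b0 intro!: mult_mono Suc.IH b Suc.prems)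
  also have "\<dots> = (real n * b) ^ Suc k" by simp
  finally show ?case .
qed

text \<open>The exponential series of \<open>real n * b * norm z\<close> dominates. Keeping
  \<open>z\<close> outside the matrix power makes every entry an ordinary power series in
  \<open>z\<close>, open to termwise differentiation.\<close>

lemma mat_exp_series_summable:
  fixes A :: "complex mat"
  assumes A: "A \<in> carrier_mat n n" and ij: "i < n" "j < n"
  shows "summable (\<lambda>k. (A ^\<^sub>m k) $$ (i, j) / fact k * z ^ k)"
proof -
  \<comment> \<open>Any common bound of the entries would do; each entry norm is one summand of this
    sum of nonnegative terms.\<close>
  define b where "b = (\<Sum>p\<in>{..<n} \<times> {..<n}. norm (A $$ p))"
  have b: "norm (A $$ (i, j)) \<le> b" if "i < n" "j < n" for i j
    unfolding b_def using that by (intro member_le_sum) auto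
  show ?thesis
  proof (rule summable_comparison_test')
    show "summable (\<lambda>k. (real n * b * norm z) ^ k /\<^sub>R fact k)"
      by (rule summable_exp_generic)
    fix k :: nat
    have "norm ((A ^\<^sub>m k) $$ (i, j) / fact k * z ^ k)
        = norm ((A ^\<^sub>m k) $$ (i, j)) * (norm z ^ k / fact k)"
      by (simp add: norm_mult norm_divide norm_power)
    also have "\<dots> \<le> (real n * b) ^ k * (norm z ^ k / fact k)"
      by (intro mult_right_mono pow_mat_entry_bound[OF A b ij]) auto
    also have "\<dots> = (real n * b * norm z) ^ k /\<^sub>R fact k"
      by (simp add: power_mult_distrib divide_inverse mult_ac)
    finally show "norm ((A ^\<^sub>m k) $$ (i, j) / fact k * z ^ k) \<le> \<dots>" .
  qed
qed

lemma smult_pow_mat: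
  fixes A :: "complex mat"
  assumes A: "A \<in> carrier_mat n n"
  shows "(z \<cdot>\<^sub>m A) ^\<^sub>m k = z ^ k \<cdot>\<^sub>m (A ^\<^sub>m k)"
proof (induction k)
  case 0
  show ?case using A by (intro eq_matI) auto
next
  case (Suc k)
  show ?case
    using A pow_carrier_mat[OF A, of k]
    by (simp add: Suc mult_smult_distrib[of _ n n _ n] mult_smult_assoc_mat[of _ n n _ n])
      (intro eq_matI, auto)
qed

lemma mat_exp_carrier [simp]: "A \<in> carrier_mat n n \<Longrightarrow> mat_exp A \<in> carrier_mat n n"
  by (simp add: mat_exp_def)

lemma mat_exp_smult_index:
  assumes A: "A \<in> carrier_mat n n" and ij: "i < n" "j < n"
  shows "mat_exp (z \<cdot>\<^sub>m A) $$ (i, j) = (\<Sum>k. (A ^\<^sub>m k) $$ (i, j) / fact k * z ^ k)"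
  using A ij pow_carrier_mat[OF A]
  by (simp add: mat_exp_def smult_pow_mat[OF A] mult_ac)

lemma mat_exp_smult_zero:
  assumes A: "A \<in> carrier_mat n n"
  shows "mat_exp (0 \<cdot>\<^sub>m A) = 1\<^sub>m n"
proof (rule eq_matI)
  fix i j assume "i < dim_row (1\<^sub>m n :: complex mat)" "j < dim_col (1\<^sub>m n :: complex mat)"
  then have ij: "i < n" "j < n" by auto
  then show "mat_exp (0 \<cdot>\<^sub>m A) $$ (i, j) = 1\<^sub>m n $$ (i, j)"
    using A unfolding mat_exp_smult_index[OF A ij] powser_zero by simp
qed (use A in \<open>auto simp: mat_exp_def\<close>)

text \<open>The power series of an entry converges in the whole plane, so it may be differentiated
  term by term. The new coefficients contain \<open>A ^\<^sub>m Suc k\<close>, from which a left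
  factor \<open>A\<close> splits off.\<close>

lemma mat_exp_has_field_derivative:
  assumes A: "A \<in> carrier_mat n n" and ij: "i < n" "j < n"
  shows "((\<lambda>z. mat_exp (z \<cdot>\<^sub>m A) $$ (i, j)) has_field_derivative
           (A * mat_exp (z \<cdot>\<^sub>m A)) $$ (i, j)) (at z)"
proof -
  define c where "c = (\<lambda>i j k. (A ^\<^sub>m k) $$ (i, j) / fact k)"
  have pow: "A ^\<^sub>m k \<in> carrier_mat n n" for k by (rule pow_carrier_mat[OF A])
  have summ: "summable (\<lambda>k. c i j k * z ^ k)" if "i < n" "j < n" for i j z
    unfolding c_def by (rule mat_exp_series_summable[OF A that])
  \<comment> \<open>Powers grow by a factor on the right, whereas the differential equation has
    \<open>A\<close> on the left.\<close>
  have comm: "A ^\<^sub>m Suc k = A * A ^\<^sub>m k" for k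
  proof (induction k)
    case (Suc k)
    then show ?case using assoc_mult_mat[OF A pow[of k] A] by simp
  qed (use A in simp)
  have diffs: "diffs (c i j) k * z ^ k = (\<Sum>l<n. A $$ (i, l) * (c l j k * z ^ k))" for k
  proof -
    \<comment> \<open>\<open>diffs\<close> shifts the index and multiplies by \<open>Suc k\<close>,
      which reduces \<open>fact (Suc k)\<close> to \<open>fact k\<close>.\<close>
    have "diffs (c i j) k = (A ^\<^sub>m Suc k) $$ (i, j) / fact k"
      by (simp add: diffs_def c_def field_simps del: pow_mat.simps of_nat_Suc)
    also have "\<dots> = (\<Sum>l<n. A $$ (i, l) * c l j k)"
      unfolding comm using A ij pow[of k]
      by (auto simp: scalar_prod_def atLeast0LessThan c_def sum_divide_distrib)
    finally show ?thesis by (simp add: sum_distrib_right mult.assoc)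
  qed
  have "(\<Sum>k. diffs (c i j) k * z ^ k) = (\<Sum>l<n. A $$ (i, l) * (\<Sum>k. c l j k * z ^ k))"
    unfolding diffs using ij
    by (subst suminf_sum) (auto intro!: summable_mult summ sum.cong suminf_mult)
  also have "\<dots> = (A * mat_exp (z \<cdot>\<^sub>m A)) $$ (i, j)"
    using A ij carrier_matD[OF mat_exp_carrier[of "z \<cdot>\<^sub>m A" n]]
    by (simp add: scalar_prod_def atLeast0LessThan c_def mat_exp_smult_index[OF A] cong: sum.cong_simp)
  finally show ?thesis
    using termdiffs_strong_converges_everywhere[of "c i j" z, OF summ[OF ij]]
    by (simp add: mat_exp_smult_index[OF A ij] c_def)
qed

section \<open>The Schroedinger equation\<close>

text \<open>The complex derivative of the exponential is pulled back along
  \<open>z = - \<i> * t\<close>. This supplies an explicit solution with which uniqueness can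
  compare any given one.\<close>

lemma schroedinger_solution_mat_exp:
  assumes A: "A \<in> carrier_mat n n" and v: "v \<in> carrier_vec n"
  shows "schroedinger_solution A v (\<lambda>t. mat_exp ((- \<i> * complex_of_real t) \<cdot>\<^sub>m A) *\<^sub>v v)"
proof -
  define E where "E = (\<lambda>z. mat_exp (z \<cdot>\<^sub>m A))"
  have E: "E z \<in> carrier_mat n n" for z unfolding E_def using A by simp
  have "((\<lambda>s. (E (- \<i> * complex_of_real s) *\<^sub>v v) $ i) has_vector_derivative
          ((- \<i>) \<cdot>\<^sub>v (A *\<^sub>v (E (- \<i> * complex_of_real t) *\<^sub>v v))) $ i) (at t within {0..})"
    if i: "i < n" for i t
  proof -
    have "((\<lambda>z. \<Sum>j<n. E z $$ (i, j) * v $ j) has_field_derivative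
            (\<Sum>j<n. (A * E z) $$ (i, j) * v $ j)) (at z)" for z
      unfolding E_def
      by (intro DERIV_sum DERIV_cmult_right mat_exp_has_field_derivative[OF A i]) auto
    moreover have "(\<lambda>z. (E z *\<^sub>v v) $ i) = (\<lambda>z. \<Sum>j<n. E z $$ (i, j) * v $ j)"
      by (rule ext) (rule mult_mat_vec_index_sum[OF E v i])
    moreover have "(\<Sum>j<n. (A * E z) $$ (i, j) * v $ j) = (A *\<^sub>v (E z *\<^sub>v v)) $ i" for z
    proof -
      have "A *\<^sub>v (E z *\<^sub>v v) = A * E z *\<^sub>v v"
        using assoc_mult_mat_vec[OF A E v] by simp
      moreover have "(\<Sum>j<n. (A * E z) $$ (i, j) * v $ j) = (A * E z *\<^sub>v v) $ i"
        by (rule mult_mat_vec_index_sum[OF mult_carrier_mat[OF A E] v i, symmetric])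
      ultimately show ?thesis by simp
    qed
    ultimately have "((\<lambda>z. (E z *\<^sub>v v) $ i) has_field_derivative (A *\<^sub>v (E z *\<^sub>v v)) $ i) (at z)" for z
      by simp
    \<comment> \<open>The inner map \<open>w \<mapsto> - \<i> * w\<close> contributes the factor of
      the equation. Here \<open>w\<close> is still complex; restricting it to real times comes
      afterwards.\<close>
    from DERIV_chain2[OF this DERIV_cmult[OF DERIV_ident]]
    have "((\<lambda>w. (E (- \<i> * w) *\<^sub>v v) $ i) has_field_derivative
            (A *\<^sub>v (E (- \<i> * w) *\<^sub>v v)) $ i * (- \<i> * 1)) (at w)" for w .
    from has_vector_derivative_real_field[OF this] show ?thesis
      using A E v i by (simp add: mult.commute)
  qed
  then show ?thesis
    using A mult_mat_vec_carrier[OF E v] v mat_exp_smult_zero[OF A]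
    by (auto simp: schroedinger_solution_def has_cvec_derivative_def E_def)
qed

text \<open>The difference of two solutions is again a solution, and its squared norm is constant
  because \<open>-\<i>A\<close> is skew-Hermitian.\<close>

lemma schroedinger_solution_unique:
  assumes A: "A \<in> carrier_mat n n" and herm: "hermitian_mat A"
    and f: "schroedinger_solution A v f" and g: "schroedinger_solution A v g" and t: "0 \<le> t"
  shows "f t = g t"
proof -
  have fc: "f s \<in> carrier_vec n" and gc: "g s \<in> carrier_vec n" if "0 \<le> s" for s
    using f g A that by (auto simp: schroedinger_solution_def)
  define w where "w = (\<lambda>s. f s - g s)"
  have wc: "w s \<in> carrier_vec n" if "0 \<le> s" for s using fc gc that by (simp add: w_def)
  \<comment> \<open>\<open>f\<close> and \<open>g\<close> are known to have length \<open>n\<close>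
    only at times \<open>s \<ge> 0\<close>, so a component of \<open>w\<close> splits as a
    difference only there. \<open>y\<close> is that difference at every time, which lets the
    derivative rules apply directly.\<close>
  define y where "y = (\<lambda>i s. f s $ i - g s $ i)"
  have wy: "w s $ i = y i s" if "0 \<le> s" "i < n" for s i
    using gc[OF that(1)] that(2) by (simp add: w_def y_def)
  have y': "(y i has_vector_derivative - \<i> * (A *\<^sub>v w s) $ i) (at s within {0..})"
    if s: "0 \<le> s" and i: "i < n" for s i
  proof -
    have *: "((\<lambda>s. h s $ i) has_vector_derivative - \<i> * (A *\<^sub>v h s) $ i) (at s within {0..})"
      if "schroedinger_solution A v h" for h
      using that s i A by (auto simp: schroedinger_solution_def has_cvec_derivative_def)
    have "A *\<^sub>v w s = A *\<^sub>v f s - A *\<^sub>v g s"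
      unfolding w_def by (rule mult_minus_distrib_mat_vec[OF A fc[OF s] gc[OF s]])
    then have "(A *\<^sub>v w s) $ i = (A *\<^sub>v f s) $ i - (A *\<^sub>v g s) $ i"
      using A i gc[OF s] by simp
    then have "- \<i> * (A *\<^sub>v w s) $ i = - \<i> * (A *\<^sub>v f s) $ i - - \<i> * (A *\<^sub>v g s) $ i"
      by (simp only: right_diff_distrib)
    with has_vector_derivative_diff[OF *[OF f] *[OF g]] show ?thesis
      unfolding y_def by (simp only:)
  qed
  \<comment> \<open>The squared norm of \<open>w\<close>, kept complex and written as a finite sum
    of products so that it can be differentiated termwise.\<close>
  define q where "q = (\<lambda>s. \<Sum>i<n. y i s * cnj (y i s))"
  have qw: "q s = w s \<bullet>c w s" if "0 \<le> s" for s
    using wc[OF that] wy[OF that] by (auto simp: q_def scalar_prod_def atLeast0LessThan)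
  have q': "(q has_vector_derivative 0) (at s within {0..})" if s: "0 \<le> s" for s
  proof -
    have "(q has_vector_derivative
        (\<Sum>i<n. y i s * cnj (- \<i> * (A *\<^sub>v w s) $ i) + (- \<i> * (A *\<^sub>v w s) $ i) * cnj (y i s)))
        (at s within {0..})"
      unfolding q_def using y'[OF s]
      by (intro has_vector_derivative_sum has_vector_derivative_mult has_vector_derivative_cnj) auto
    also have "(\<Sum>i<n. y i s * cnj (- \<i> * (A *\<^sub>v w s) $ i) + (- \<i> * (A *\<^sub>v w s) $ i) * cnj (y i s))
        = \<i> * (w s \<bullet>c (A *\<^sub>v w s)) - \<i> * ((A *\<^sub>v w s) \<bullet>c w s)"
      using A wc[OF s] wy[OF s]
      by (auto simp: scalar_prod_def atLeast0LessThan sum_distrib_left sum.distrib sum_negf mult_ac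
          simp flip: sum_subtractf intro!: sum.cong)
    \<comment> \<open>Moving \<open>A\<close> across the inner product yields its adjoint, which is
      \<open>A\<close> itself, so the two terms cancel.\<close>
    also have "\<dots> = 0"
      using cscalar_mult_mat_vec[OF A wc[OF s] wc[OF s]] herm by (simp add: hermitian_mat_def)
    finally show ?thesis .
  qed
  have "w 0 = 0\<^sub>v n"
    using f g gc[of 0] by (simp add: w_def schroedinger_solution_def)
  then have q0: "q 0 = 0" using qw[of 0] by simp
  have "q t = 0"
  proof (cases "t = 0")
    case True
    then show ?thesis using q0 by simp
  next
    case False
    \<comment> \<open>The constancy criterion is about real functions, hence the split into real and
      imaginary part.\<close>
    have D: "((\<lambda>s. Re (q s)) has_real_derivative 0) (at s within {0..})"
      and D': "((\<lambda>s. Im (q s)) has_real_derivative 0) (at s within {0..})" if "0 \<le> s" for s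
      using q'[OF that] by (auto simp: has_vector_derivative_complex_iff)
    \<comment> \<open>At time 0 the one-sided derivative is used only for continuity. At interior
      times, restricting to the open half-line gives a two-sided derivative.\<close>
    have const: "h t = h 0" if h: "\<And>s. 0 \<le> s \<Longrightarrow> (h has_real_derivative 0) (at s within {0..})"
      for h :: "real \<Rightarrow> real"
    proof (rule DERIV_isconst_end[where f = h])
      show "0 < t" using t False by simp
      have "continuous_on {0..} h"
        using h by (intro DERIV_continuous_on) auto
      then show "continuous_on {0..t} h" by (rule continuous_on_subset) auto
      fix s assume "0 < s" "s < t"
      then show "(h has_real_derivative 0) (at s)"
        using has_field_derivative_subset[OF h[of s], of "{0<..}"]
        by (simp add: subset_iff at_within_open[of s "{0<..}"])
    qed
    with q0 const[OF D] const[OF D'] show ?thesis by (simp add: complex_eq_iff)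
  qed
  then have "w t = 0\<^sub>v n" using qw[OF t] wc[OF t] by simp
  show ?thesis
  proof (rule eq_vecI)
    fix i assume "i < dim_vec (g t)"
    then show "f t $ i = g t $ i"
      using \<open>w t = 0\<^sub>v n\<close> gc[OF t] wy[OF t, of i] by (simp add: y_def)
  qed (use fc[OF t] gc[OF t] in auto)
qed

section \<open>Orthonormal columns\<close>

lemma adjoint_mult_orthonormal_cols:
  fixes S :: "complex mat"
  assumes S: "S \<in> carrier_mat n d"
    and "\<And>i j. i < d \<Longrightarrow> j < d \<Longrightarrow> col S i \<bullet>c col S j = (if i = j then 1 else 0)"
  shows "mat_adjoint S * S = 1\<^sub>m d"
proof (rule eq_matI)
  note S' = mat_adjoint_carrier[OF S]
  fix i j assume "i < dim_row (1\<^sub>m d :: complex mat)" "j < dim_col (1\<^sub>m d :: complex mat)"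
  then have ij: "i < d" "j < d" by auto
  \<comment> \<open>The columns appear in reversed order because the conjugation sits on the second
    argument.\<close>
  have "(mat_adjoint S * S) $$ (i, j) = col S j \<bullet>c col S i"
    using S S' ij by (auto simp: scalar_prod_def mat_adjoint_index mult_ac intro!: sum.cong)
  then show "(mat_adjoint S * S) $$ (i, j) = 1\<^sub>m d $$ (i, j)"
    using assms(2) ij by auto
qed (use S mat_adjoint_carrier[OF S] in auto)

text \<open>A basis of \<open>Z\<close> spans it inside \<open>Z\<close>; spans in a submodule agree
  with spans in the ambient space, and there the span of the columns is the column space of
  \<open>S\<close>.\<close>

lemma orthonormal_basis_cols_range:
  assumes Z: "cvec_subspace n Z d" and S: "S \<in> carrier_mat n d"
    and B: "orthonormal_basis_cols n Z S"
  shows "Z = {S *\<^sub>v x | x. x \<in> carrier_vec d}"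
proof -
  interpret vec_space "TYPE(complex)" n .
  have sub: "VectorSpace.subspace class_ring Z V" using Z by (simp add: cvec_subspace_def)
  then have subm: "submodule class_ring Z V" by (simp add: VectorSpace.subspace_def)
  interpret Z: vectorspace class_ring "V\<lparr>carrier := Z\<rparr>"
    using subspace_is_vs[OF sub] by simp
  have "Z.basis (set (cols S))" using B by (simp add: orthonormal_basis_cols_def)
  then have "Z.span (set (cols S)) = Z" "set (cols S) \<subseteq> Z"
    by (simp_all add: Z.basis_def)
  with span_li_not_depend(1)[OF _ subm] have "Z = col_space S"
    by (simp add: col_space_def)
  then show ?thesis using col_space_eq[OF S] S by auto
qed

text \<open>By \<open>SS\<close>, \<open>mat_adjoint S\<close> kills the residual of
  \<open>v\<close>; passing to the adjoint, the residual is orthogonal to every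
  \<open>S *\<^sub>v x\<close>, hence to \<open>Z\<close>.\<close>

lemma orthogonal_projection_orthonormal_cols:
  assumes S: "S \<in> carrier_mat n d" and SS: "mat_adjoint S * S = 1\<^sub>m d"
    and Z: "Z = {S *\<^sub>v x | x. x \<in> carrier_vec d}"
  shows "is_orthogonal_projection n Z (S * mat_adjoint S)"
  unfolding is_orthogonal_projection_def
proof (intro conjI ballI)
  note S' = mat_adjoint_carrier[OF S]
  show "S * mat_adjoint S \<in> carrier_mat n n" using S S' by simp
  fix v :: "complex vec" assume v: "v \<in> carrier_vec n"
  have Pv: "S * mat_adjoint S *\<^sub>v v = S *\<^sub>v (mat_adjoint S *\<^sub>v v)"
    by (rule assoc_mult_mat_vec[OF S S' v])
  then show "S * mat_adjoint S *\<^sub>v v \<in> Z"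
    using Z S' v by (auto intro!: mult_mat_vec_carrier)
  fix z assume "z \<in> Z"
  then obtain x where x: "x \<in> carrier_vec d" and z: "z = S *\<^sub>v x" using Z by auto
  let ?u = "S *\<^sub>v (mat_adjoint S *\<^sub>v v)"
  have u: "?u \<in> carrier_vec n" using S S' v by (auto intro!: mult_mat_vec_carrier)
  have S'v: "mat_adjoint S *\<^sub>v v \<in> carrier_vec d" using S' v by (rule mult_mat_vec_carrier)
  have "mat_adjoint S *\<^sub>v (v - ?u) = mat_adjoint S *\<^sub>v v - mat_adjoint S *\<^sub>v ?u"
    by (rule mult_minus_distrib_mat_vec[OF S' v u])
  also have "mat_adjoint S *\<^sub>v ?u = mat_adjoint S *\<^sub>v v"
    using assoc_mult_mat_vec[OF S' S S'v] SS S'v by simp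
  finally have "mat_adjoint S *\<^sub>v (v - ?u) = 0\<^sub>v d" using S'v by simp
  moreover have "(v - ?u) \<bullet>c (S *\<^sub>v x) = (mat_adjoint S *\<^sub>v (v - ?u)) \<bullet>c x"
    by (rule cscalar_mult_mat_vec[OF S _ x]) (use u v in simp)
  ultimately show "(v - S * mat_adjoint S *\<^sub>v v) \<bullet>c z = 0"
    using x by (simp add: Pv z)
qed

section \<open>Lifting the reduced dynamics\<close>

text \<open>\<open>A\<close> maps \<open>S *\<^sub>v f t + r\<close> to
  \<open>S *\<^sub>v (B *\<^sub>v f t)\<close>, by intertwining and \<open>Ar\<close>, while the
  constant \<open>r\<close> adds nothing to the time derivative.\<close>

lemma schroedinger_solution_lift:
  assumes B: "B \<in> carrier_mat d d" and A: "A \<in> carrier_mat n n" and S: "S \<in> carrier_mat n d"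
    and intertwine: "A * S = S * B"
    and r: "r \<in> carrier_vec n" and Ar: "A *\<^sub>v r = 0\<^sub>v n"
    and f: "schroedinger_solution B v f"
  shows "schroedinger_solution A (S *\<^sub>v v + r) (\<lambda>t. S *\<^sub>v f t + r)"
proof -
  have fc: "f t \<in> carrier_vec d" if "0 \<le> t" for t
    using f B that by (auto simp: schroedinger_solution_def)
  have "((\<lambda>s. (S *\<^sub>v f s + r) $ i) has_vector_derivative
         ((- \<i>) \<cdot>\<^sub>v (A *\<^sub>v (S *\<^sub>v f t + r))) $ i) (at t within {0..})"
    if t: "0 \<le> t" and i: "i < n" for t i
  proof -
    have Bf: "B *\<^sub>v f t \<in> carrier_vec d" using B fc[OF t] by (rule mult_mat_vec_carrier)
    have Sf: "S *\<^sub>v f t \<in> carrier_vec n" using S fc[OF t] by (rule mult_mat_vec_carrier)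
    have f': "((\<lambda>s. f s $ j) has_vector_derivative - \<i> * (B *\<^sub>v f t) $ j) (at t within {0..})"
      if "j < d" for j
      using f t that B by (auto simp: schroedinger_solution_def has_cvec_derivative_def)
    have "((\<lambda>s. (\<Sum>j<d. S $$ (i, j) * f s $ j) + r $ i) has_vector_derivative
        (\<Sum>j<d. S $$ (i, j) * (- \<i> * (B *\<^sub>v f t) $ j)) + 0) (at t within {0..})"
      by (intro has_vector_derivative_add has_vector_derivative_sum has_vector_derivative_mult_right
          has_vector_derivative_const f') auto
    moreover have "(S *\<^sub>v f s + r) $ i = (\<Sum>j<d. S $$ (i, j) * f s $ j) + r $ i" if "0 \<le> s" for s
      using S r fc[OF that] i by (auto simp: scalar_prod_def atLeast0LessThan)
    moreover have "((- \<i>) \<cdot>\<^sub>v (A *\<^sub>v (S *\<^sub>v f t + r))) $ i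
        = (\<Sum>j<d. S $$ (i, j) * (- \<i> * (B *\<^sub>v f t) $ j)) + 0"
    proof -
      have "A *\<^sub>v (S *\<^sub>v f t + r) = A *\<^sub>v (S *\<^sub>v f t) + A *\<^sub>v r"
        by (rule mult_add_distrib_mat_vec[OF A Sf r])
      also have "\<dots> = A * S *\<^sub>v f t"
        using assoc_mult_mat_vec[OF A S fc[OF t]] Ar A Sf mult_mat_vec_carrier[OF A Sf] by simp
      also have "\<dots> = S *\<^sub>v (B *\<^sub>v f t)"
        using assoc_mult_mat_vec[OF S B fc[OF t]] intertwine by simp
      finally show ?thesis
        using S i
        by (simp add: mult_mat_vec_index_sum[OF S Bf i] sum_distrib_left sum_negf mult_ac
            del: index_mult_mat_vec)
    qed
    \<comment> \<open>The component formula holds only for \<open>s \<ge> 0\<close>, which is enough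
      for a derivative within \<open>{0..}\<close>.\<close>
    ultimately show ?thesis
      using t by (auto simp: has_vector_derivative_def elim!: has_derivative_transform[rotated 2])
  qed
  moreover have "S *\<^sub>v f t + r \<in> carrier_vec n" for t
    using carrier_matD(1)[OF S] r by (intro carrier_vecI) simp
  ultimately show ?thesis
    using f A S by (auto simp: schroedinger_solution_def has_cvec_derivative_def)
qed

theorem theorem1:
  fixes n N d :: nat
    and H S P\<^sub>Z H\<^sub>Z H\<^sub>Z' :: "complex mat"
    and Z :: "complex vec set"
    and \<psi>\<^sub>0 r :: "complex vec"
    and \<psi> \<psi>' :: "real \<Rightarrow> complex vec"
    and U\<^sub>Z U\<^sub>Z' :: "real \<Rightarrow> complex mat"
  assumes "n \<ge> 1" and "N = 2 ^ n"
    and "H \<in> carrier_mat N N" and "hermitian_mat H"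
    and "cvec_subspace N Z d"
    and "S \<in> carrier_mat N d" and "orthonormal_basis_cols N Z S"
    and "P\<^sub>Z = S * mat_adjoint S"
    and "H\<^sub>Z = P\<^sub>Z * H * P\<^sub>Z"
    and "H\<^sub>Z' = mat_adjoint S * H * S"
    and "quantum_state n \<psi>\<^sub>0"
    and "schroedinger_solution H\<^sub>Z \<psi>\<^sub>0 \<psi>"
    and "schroedinger_solution H\<^sub>Z' (mat_adjoint S *\<^sub>v \<psi>\<^sub>0) \<psi>'"
    and "r = (1\<^sub>m N - P\<^sub>Z) *\<^sub>v \<psi>\<^sub>0"
    and "\<And>t. U\<^sub>Z t = mat_exp ((- \<i> * complex_of_real t) \<cdot>\<^sub>m H\<^sub>Z)"
    and "\<And>t. U\<^sub>Z' t = mat_exp ((- \<i> * complex_of_real t) \<cdot>\<^sub>m H\<^sub>Z')"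
  shows "mat_adjoint S * S = 1\<^sub>m d \<and> is_orthogonal_projection N Z P\<^sub>Z \<and>
    (\<forall>t \<ge> 0. \<psi> t - r = S *\<^sub>v \<psi>' t) \<and>
    (\<forall>t \<ge> 0.
       U\<^sub>Z t *\<^sub>v \<psi>\<^sub>0 - r = S *\<^sub>v \<psi>' t \<and>
       S *\<^sub>v \<psi>' t =
         (S * mat_exp ((- \<i> * complex_of_real t) \<cdot>\<^sub>m H\<^sub>Z') * mat_adjoint S) *\<^sub>v \<psi>\<^sub>0 \<and>
       (S * mat_exp ((- \<i> * complex_of_real t) \<cdot>\<^sub>m H\<^sub>Z') * mat_adjoint S) *\<^sub>v \<psi>\<^sub>0 =
         (S * U\<^sub>Z' t * mat_adjoint S) *\<^sub>v \<psi>\<^sub>0)"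
proof -
  note S = \<open>S \<in> carrier_mat N d\<close> and H = \<open>H \<in> carrier_mat N N\<close>
  note S' = mat_adjoint_carrier[OF S]
  have orth: "col S i \<bullet>c col S j = (if i = j then 1 else 0)" if "i < d" "j < d" for i j
    using \<open>orthonormal_basis_cols N Z S\<close> S that by (auto simp: orthonormal_basis_cols_def)
  have SS: "mat_adjoint S * S = 1\<^sub>m d" by (rule adjoint_mult_orthonormal_cols[OF S orth])
  note rng = orthonormal_basis_cols_range[OF \<open>cvec_subspace N Z d\<close> S \<open>orthonormal_basis_cols N Z S\<close>]
  have proj: "is_orthogonal_projection N Z P\<^sub>Z"
    unfolding \<open>P\<^sub>Z = _\<close> by (rule orthogonal_projection_orthonormal_cols[OF S SS rng])
  have P: "P\<^sub>Z \<in> carrier_mat N N" using S S' \<open>P\<^sub>Z = _\<close> by simp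
  have PH: "P\<^sub>Z * H \<in> carrier_mat N N" and S'H: "mat_adjoint S * H \<in> carrier_mat d N"
    using P H S' by auto
  have A: "H\<^sub>Z \<in> carrier_mat N N" using PH P \<open>H\<^sub>Z = _\<close> by simp
  have B: "H\<^sub>Z' \<in> carrier_mat d d" using S'H S \<open>H\<^sub>Z' = _\<close> by simp
  have \<psi>\<^sub>0: "\<psi>\<^sub>0 \<in> carrier_vec N"
    using \<open>quantum_state n \<psi>\<^sub>0\<close> \<open>N = 2 ^ n\<close> by (simp add: quantum_state_def)
  have S'\<psi>: "mat_adjoint S *\<^sub>v \<psi>\<^sub>0 \<in> carrier_vec d" using S' \<psi>\<^sub>0 by (rule mult_mat_vec_carrier)
  have P\<psi>: "P\<^sub>Z *\<^sub>v \<psi>\<^sub>0 = S *\<^sub>v (mat_adjoint S *\<^sub>v \<psi>\<^sub>0)"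
    unfolding \<open>P\<^sub>Z = _\<close> by (rule assoc_mult_mat_vec[OF S S' \<psi>\<^sub>0])
  have P\<psi>c: "P\<^sub>Z *\<^sub>v \<psi>\<^sub>0 \<in> carrier_vec N" using P \<psi>\<^sub>0 by (rule mult_mat_vec_carrier)
  have PS: "P\<^sub>Z * S = S"
    unfolding \<open>P\<^sub>Z = _\<close> using assoc_mult_mat[OF S S' S] SS S by simp
  have PP: "P\<^sub>Z * P\<^sub>Z = P\<^sub>Z"
    using assoc_mult_mat[OF P S S'] PS \<open>P\<^sub>Z = _\<close> by simp
  have adjP: "mat_adjoint P\<^sub>Z = P\<^sub>Z"
    unfolding \<open>P\<^sub>Z = _\<close> using mat_adjoint_mult[OF S S'] by simp
  have adjH: "mat_adjoint H = H" using \<open>hermitian_mat H\<close> by (simp add: hermitian_mat_def)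
  \<comment> \<open>Uniqueness will be applied to the full and to the reduced equation, so both
    generators must be Hermitian.\<close>
  have "mat_adjoint H\<^sub>Z = P\<^sub>Z * (H * P\<^sub>Z)"
    unfolding \<open>H\<^sub>Z = _\<close> by (simp add: mat_adjoint_mult[OF PH P] mat_adjoint_mult[OF P H] adjP adjH)
  then have hermA: "hermitian_mat H\<^sub>Z"
    unfolding hermitian_mat_def \<open>H\<^sub>Z = _\<close> using assoc_mult_mat[OF P H P] by simp
  have "mat_adjoint H\<^sub>Z' = mat_adjoint S * (H * S)"
    unfolding \<open>H\<^sub>Z' = _\<close> by (simp add: mat_adjoint_mult[OF S'H S] mat_adjoint_mult[OF S' H] adjH)
  then have hermB: "hermitian_mat H\<^sub>Z'"
    unfolding hermitian_mat_def \<open>H\<^sub>Z' = _\<close> using assoc_mult_mat[OF S' H S] by simp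
  \<comment> \<open>\<open>PS\<close> absorbs the right projection of \<open>H\<^sub>Z\<close>; the
    left one, written as \<open>S * mat_adjoint S\<close>, provides the factor \<open>S\<close> and
    completes \<open>H\<^sub>Z'\<close>.\<close>
  have intertwine: "H\<^sub>Z * S = S * H\<^sub>Z'"
  proof -
    have "H\<^sub>Z * S = P\<^sub>Z * H * S"
      unfolding \<open>H\<^sub>Z = _\<close> using assoc_mult_mat[OF PH P S] PS by simp
    also have "\<dots> = S * mat_adjoint S * (H * S)"
      using assoc_mult_mat[OF P H S] \<open>P\<^sub>Z = _\<close> by simp
    also have "\<dots> = S * H\<^sub>Z'"
      unfolding \<open>H\<^sub>Z' = _\<close> using assoc_mult_mat[OF S S', of "H * S" d] assoc_mult_mat[OF S' H S] H S
      by simp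
    finally show ?thesis .
  qed
  have r: "r = \<psi>\<^sub>0 - P\<^sub>Z *\<^sub>v \<psi>\<^sub>0"
    using \<open>r = _\<close> minus_mult_distrib_mat_vec[OF one_carrier_mat P \<psi>\<^sub>0] \<psi>\<^sub>0 by simp
  have rc: "r \<in> carrier_vec N" using r P\<psi>c \<psi>\<^sub>0 by simp
  \<comment> \<open>Idempotence gives \<open>P\<^sub>Z *\<^sub>v r = 0\<^sub>v N\<close>, and
    \<open>P\<^sub>Z\<close> is the rightmost factor of \<open>H\<^sub>Z\<close>.\<close>
  have Ar: "H\<^sub>Z *\<^sub>v r = 0\<^sub>v N"
  proof -
    have "P\<^sub>Z *\<^sub>v r = 0\<^sub>v N"
      unfolding r
      using mult_minus_distrib_mat_vec[OF P \<psi>\<^sub>0 P\<psi>c] assoc_mult_mat_vec[OF P P \<psi>\<^sub>0] PP P\<psi>c by simp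
    then show ?thesis
      unfolding \<open>H\<^sub>Z = _\<close> using assoc_mult_mat_vec[OF PH P rc] carrier_matD[OF PH]
      by (auto simp: scalar_prod_def intro: eq_vecI)
  qed
  note sol = \<open>schroedinger_solution H\<^sub>Z \<psi>\<^sub>0 \<psi>\<close>
    and sol' = \<open>schroedinger_solution H\<^sub>Z' (mat_adjoint S *\<^sub>v \<psi>\<^sub>0) \<psi>'\<close>
  have init: "S *\<^sub>v (mat_adjoint S *\<^sub>v \<psi>\<^sub>0) + r = \<psi>\<^sub>0"
    unfolding P\<psi>[symmetric] r
    using carrier_vecD[OF P\<psi>c] carrier_vecD[OF \<psi>\<^sub>0]
    by (intro eq_vecI) (simp_all del: index_mult_mat_vec)
  \<comment> \<open>Rewriting with \<open>init\<close> gives the lifted curve the initial value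
    \<open>\<psi>\<^sub>0\<close>, so that it can be compared first with \<open>\<psi>\<close> and
    then with the exponential curve.\<close>
  note lift = schroedinger_solution_lift[OF B A S intertwine rc Ar sol', unfolded init]
  have \<psi>'c: "S *\<^sub>v \<psi>' t \<in> carrier_vec N" for t
    using carrier_matD(1)[OF S] by (intro carrier_vecI) simp
  have minus_r: "x - r = S *\<^sub>v \<psi>' t" if "x = S *\<^sub>v \<psi>' t + r" for x t
    using that carrier_vecD[OF rc] carrier_vecD[OF \<psi>'c[of t]]
    by (intro eq_vecI) (simp_all del: index_mult_mat_vec)
  have eq1: "\<psi> t - r = S *\<^sub>v \<psi>' t" if "0 \<le> t" for t
    by (rule minus_r[OF schroedinger_solution_unique[OF A hermA sol lift that]])
  have eq2: "U\<^sub>Z t *\<^sub>v \<psi>\<^sub>0 - r = S *\<^sub>v \<psi>' t" if "0 \<le> t" for t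
    unfolding \<open>\<And>t. U\<^sub>Z t = _\<close>
    by (rule minus_r[OF schroedinger_solution_unique[OF A hermA
          schroedinger_solution_mat_exp[OF A \<psi>\<^sub>0] lift that]])
  \<comment> \<open>Here uniqueness is used in dimension \<open>d\<close>: it identifies
    \<open>\<psi>'\<close> with the exponential curve of \<open>H\<^sub>Z'\<close>, and
    reassociating the products does the rest.\<close>
  have eq3: "S *\<^sub>v \<psi>' t
      = (S * mat_exp ((- \<i> * complex_of_real t) \<cdot>\<^sub>m H\<^sub>Z') * mat_adjoint S) *\<^sub>v \<psi>\<^sub>0" if "0 \<le> t" for t
  proof -
    have E: "mat_exp ((- \<i> * complex_of_real t) \<cdot>\<^sub>m H\<^sub>Z') \<in> carrier_mat d d" (is "?E \<in> _")
      using B by simp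
    have "\<psi>' t = ?E *\<^sub>v (mat_adjoint S *\<^sub>v \<psi>\<^sub>0)"
      by (rule schroedinger_solution_unique[OF B hermB sol'
            schroedinger_solution_mat_exp[OF B S'\<psi>] that])
    then show ?thesis
      using assoc_mult_mat_vec[OF S E S'\<psi>]
        assoc_mult_mat_vec[OF mult_carrier_mat[OF S E] S' \<psi>\<^sub>0] by simp
  qed
  show ?thesis
    using SS proj eq1 eq2 eq3 \<open>\<And>t. U\<^sub>Z' t = _\<close> by simp
qed

end
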